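(* Let $\Phi \in \mathbb{K}^{n\times m}$ be a frame for $\mathbb{K}^n$. Then there exists a dual frame $\Psi \in \mathbb{K}^{n\times m}$ of $\Phi$ with $\|\Psi\|_0 \le n^2$.
   Context: $\mathbb{K}$ denotes $\mathbb{R}$ or $\mathbb{C}$. A frame for $\mathbb{K}^n$ with $m$ vectors is a family $(\phi_i)_{i=1}^m$ in $\mathbb{K}^n$ for which there are constants $0<A\le B$ with $A\|x\|_2^2\le\sum_{i=1}^m|\langle x,\phi_i\rangle|^2\le B\|x\|_2^2$ for all $x\in\mathbb{K}^n$; it is identified with the $n\times m$ matrix $\Phi=[\phi_i]_{i=1}^m$ whose columns are the $\phi_i$. A dual frame of $\Phi$ is a frame $\Psi\in\mathbb{K}^{n\times m}$ for $\mathbb{K}^n$ with $\Psi\Phi^*=I_n$ (equivalently $\Phi\Psi^*=I_n$). For a matrix $\Psi$, $\|\Psi\|_0$ denotes the number of nonzero entries of $\Psi$. *)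

theory Defs
  imports "HOL-Analysis.Analysis" "Jordan_Normal_Form.Conjugate"
begin

text \<open>
  The field \<open>\<K>\<close> is a type of sort \<open>{conjugatable_field, real_normed_field}\<close>, to be instantiated with
  \<open>real\<close> (where \<open>conjugate\<close> is the identity) and \<open>complex\<close> (where \<open>conjugate\<close> is \<open>cnj\<close>).
  The norm of \<open>'a ^ 'n\<close> is the Euclidean one. The library's \<open>inner\<close> is real-valued even on
  complex vectors, hence the sesquilinear product below (linear in the first argument).
\<close>

definition sesq_inner ::
    "'a::{conjugatable_field,real_normed_field} ^ 'n \<Rightarrow> 'a ^ 'n \<Rightarrow> 'a" where
  "sesq_inner x y = (\<Sum>k\<in>UNIV. x $ k * conjugate (y $ k))"

definition conj_transpose ::
    "'a::{conjugatable_field,real_normed_field} ^ 'm ^ 'n \<Rightarrow> 'a ^ 'n ^ 'm" where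
  "conj_transpose A = (\<chi> i j. conjugate (A $ j $ i))"

definition is_frame ::
    "('m::finite \<Rightarrow> 'a::{conjugatable_field,real_normed_field} ^ 'n) \<Rightarrow> bool" where
  "is_frame \<phi> \<longleftrightarrow>
    (\<exists>A B :: real. 0 < A \<and> A \<le> B \<and>
      (\<forall>x. A * (norm x)\<^sup>2 \<le> (\<Sum>i\<in>UNIV. (norm (sesq_inner x (\<phi> i)))\<^sup>2) \<and>
           (\<Sum>i\<in>UNIV. (norm (sesq_inner x (\<phi> i)))\<^sup>2) \<le> B * (norm x)\<^sup>2))"

text \<open>An \<open>n \<times> m\<close> matrix has type \<open>'a ^ 'm ^ 'n\<close>; its columns are indexed by \<open>'m\<close>.\<close>

definition frame_matrix ::
    "'a::{conjugatable_field,real_normed_field} ^ 'm ^ 'n \<Rightarrow> bool" where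
  "frame_matrix \<Phi> \<longleftrightarrow> is_frame (\<lambda>i. column i \<Phi>)"

definition dual_frame_of ::
    "'a::{conjugatable_field,real_normed_field} ^ 'm ^ 'n \<Rightarrow> 'a ^ 'm ^ 'n \<Rightarrow> bool" where
  "dual_frame_of \<Psi> \<Phi> \<longleftrightarrow> frame_matrix \<Psi> \<and> \<Psi> ** conj_transpose \<Phi> = mat 1"

definition l0_norm :: "'a::zero ^ 'm ^ 'n \<Rightarrow> nat" where
  "l0_norm \<Psi> = card {(i, j). \<Psi> $ i $ j \<noteq> 0}"

end

theory Submission
  imports Defs
begin

text \<open>
  The lower frame bound makes the analysis matrix \<open>\<Phi>\<^sup>*\<close> injective, so its rows span \<open>\<K>\<^sup>n\<close>. Some
  \<open>n\<close> of these rows form a basis; expanding each unit vector in that basis gives a left inverse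
  \<open>\<Psi>\<close> of \<open>\<Phi>\<^sup>*\<close> with at most \<open>n\<close> nonzero columns. Finally \<open>\<Phi> \<Psi>\<^sup>* = I\<close> bounds \<open>\<Psi>\<^sup>*\<close> below, so
  \<open>\<Psi>\<close> is a frame.
\<close>

lemma matrix_vector_mult_norm_bound:
  fixes M :: "'a::real_normed_field ^ 'n ^ 'm"
  obtains K where "K > 0" "\<And>x. norm (M *v x) \<le> K * norm x"
proof -
  let ?K = "\<Sum>i\<in>UNIV. \<Sum>j\<in>UNIV. norm (M $ i $ j)"
  have bound: "norm (M *v x) \<le> ?K * norm x" for x
  proof -
    have "norm (M *v x) \<le> (\<Sum>i\<in>UNIV. norm ((M *v x) $ i))"
      unfolding norm_vec_def by (rule L2_set_le_sum) simp
    also have "\<dots> \<le> (\<Sum>i\<in>UNIV. \<Sum>j\<in>UNIV. norm (M $ i $ j) * norm x)"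
      by (auto simp: matrix_vector_mult_def norm_mult
          intro!: sum_mono sum_norm_le mult_left_mono Finite_Cartesian_Product.norm_nth_le)
    also have "\<dots> = ?K * norm x"
      by (simp add: sum_distrib_right)
    finally show ?thesis .
  qed
  \<comment> \<open>The sum of entry norms is 0 for \<open>M = 0\<close>; adding 1 makes the
    constant positive, so that \<open>1 / K\<^sup>2\<close> can later serve as a lower frame
    bound.\<close>
  have "?K * norm x \<le> (?K + 1) * norm x" for x :: "'a ^ 'n"
    by (intro mult_right_mono) auto
  then have "norm (M *v x) \<le> (?K + 1) * norm x" for x
    using bound order.trans by blast
  moreover have "?K + 1 > 0"
    by (intro add_nonneg_pos sum_nonneg) auto
  ultimately show ?thesis
    using that by blast
qed

lemma conj_transpose_mult_vec_nth:
  "(conj_transpose \<Phi> *v x) $ i = sesq_inner x (column i \<Phi>)"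
  by (simp add: matrix_vector_mult_def conj_transpose_def sesq_inner_def column_def mult.commute)

text \<open>Read from right to left, this turns the frame inequalities into two-sided norm bounds on
  the analysis operator.\<close>

lemma norm_conj_transpose_mult_vec_squared:
  "(norm (conj_transpose \<Phi> *v x))\<^sup>2 = (\<Sum>i\<in>UNIV. (norm (sesq_inner x (column i \<Phi>)))\<^sup>2)"
  by (simp add: norm_vec_def L2_set_def sum_nonneg conj_transpose_mult_vec_nth)

lemma conj_transpose_conj_transpose: "conj_transpose (conj_transpose A) = A"
  by (simp add: conj_transpose_def vec_eq_iff)

text \<open>\<open>conjugate 1\<close> is idempotent in a field, hence 0 or 1, and conjugation sends
  only 0 to 0.\<close>

lemma conjugate_one: "conjugate (1 :: 'a::conjugatable_field) = 1"
proof -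
  have "conjugate (1::'a) = conjugate 1 * conjugate 1"
    by (simp flip: conjugate_dist_mul)
  then show ?thesis
    by simp
qed

lemma conj_transpose_mat_1: "conj_transpose (mat 1) = mat 1"
  by (auto simp: conj_transpose_def mat_def vec_eq_iff conjugate_one)

lemma conj_transpose_matrix_mult:
  "conj_transpose (A ** B) = conj_transpose B ** conj_transpose A"
  by (simp add: conj_transpose_def matrix_matrix_mult_def vec_eq_iff sum_conjugate
      conjugate_dist_mul mult.commute)

lemma frame_matrix_if_right_inverse:
  assumes "\<Phi> ** conj_transpose \<Psi> = mat 1"
  shows "frame_matrix \<Psi>"
proof -
  obtain K where K: "K > 0" "\<And>x. norm (\<Phi> *v x) \<le> K * norm x"
    by (rule matrix_vector_mult_norm_bound[of \<Phi>]) blast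
  obtain L where L: "L > 0" "\<And>x. norm (conj_transpose \<Psi> *v x) \<le> L * norm x"
    by (rule matrix_vector_mult_norm_bound[of "conj_transpose \<Psi>"]) blast
  let ?A = "1 / K\<^sup>2"
  \<comment> \<open>The maximum gives \<open>?A \<le> ?B\<close> without comparing \<open>K\<close>
    and \<open>L\<close>.\<close>
  let ?B = "max ?A (L\<^sup>2)"
  have lower: "?A * (norm x)\<^sup>2 \<le> (norm (conj_transpose \<Psi> *v x))\<^sup>2" for x
  proof -
    have "norm x = norm (\<Phi> *v (conj_transpose \<Psi> *v x))"
      by (simp add: matrix_vector_mul_assoc assms)
    also have "\<dots> \<le> K * norm (conj_transpose \<Psi> *v x)"
      by (rule K)
    finally have "(norm x)\<^sup>2 \<le> (K * norm (conj_transpose \<Psi> *v x))\<^sup>2"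
      by (simp add: power_mono)
    then show ?thesis
      using K(1) by (simp add: divide_simps mult.commute)
  qed
  have upper: "(norm (conj_transpose \<Psi> *v x))\<^sup>2 \<le> ?B * (norm x)\<^sup>2" for x
  proof -
    have "(norm (conj_transpose \<Psi> *v x))\<^sup>2 \<le> (L * norm x)\<^sup>2"
      using L(2) by (simp add: power_mono)
    also have "\<dots> \<le> ?B * (norm x)\<^sup>2"
      unfolding power_mult_distrib by (intro mult_right_mono) auto
    finally show ?thesis .
  qed
  have "0 < ?A" "?A \<le> ?B"
    using K(1) by auto
  then show ?thesis
    unfolding frame_matrix_def is_frame_def norm_conj_transpose_mult_vec_squared[symmetric]
    using lower upper by blast
qed

lemma frame_matrix_imp_inj:
  assumes "frame_matrix \<Phi>"
  shows "inj ((*v) (conj_transpose \<Phi>))"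
proof -
  from assms obtain A where A: "0 < A"
    "\<And>x. A * (norm x)\<^sup>2 \<le> (norm (conj_transpose \<Phi> *v x))\<^sup>2"
    unfolding frame_matrix_def is_frame_def norm_conj_transpose_mult_vec_squared[symmetric] by blast
  have "x = 0" if "conj_transpose \<Phi> *v x = 0" for x
    using A(2)[of x] A(1) that by (simp add: mult_le_0_iff)
  \<comment> \<open>Trivial kernel and injectivity are linked through left invertibility, to which
    each is equivalent.\<close>
  then show ?thesis
    using matrix_left_invertible_injective[of "conj_transpose \<Phi>"]
      matrix_left_invertible_ker[of "conj_transpose \<Phi>"] by blast
qed

text \<open>\<open>N ** M = mat 1\<close> says that row \<open>i\<close> of \<open>N\<close>
  combines the rows of \<open>M\<close> into the \<open>i\<close>-th unit vector. Using the same
  \<open>n\<close> basis rows for every \<open>i\<close> confines the support of \<open>N\<close> to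
  \<open>n\<close> columns.\<close>

lemma sparse_left_inverse:
  fixes M :: "'a::field ^ 'n ^ 'm"
  assumes "inj ((*v) M)"
  obtains N :: "'a ^ 'm ^ 'n" where "N ** M = mat 1" "l0_norm N \<le> CARD('n)\<^sup>2"
proof -
  obtain B where B: "B \<subseteq> rows M" "vec.independent B" "rows M \<subseteq> vec.span B"
    using vec.maximal_independent_subset[of "rows M"] by blast
  have "vec.span (rows M) = UNIV"
    using assms matrix_left_invertible_injective[of M] matrix_left_invertible_span_rows_gen[of M]
    by blast
  then have span: "vec.span B = UNIV"
    using B(3) vec.span_minimal[OF B(3) vec.subspace_span] by auto
  have fin: "finite B"
    using B(2) by (rule vec.finiteI_independent)
  have card_B: "card B = CARD('n)"
    using vec.dim_eq_card[of B UNIV] B(2) span by (simp add: card_cart_basis)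
  \<comment> \<open>\<open>B\<close> consists of vectors, while columns of \<open>N\<close> are
    indexed by \<open>'m\<close>, and \<open>M\<close> may repeat a row. So \<open>g\<close> selects
    one index for each basis vector.\<close>
  have "\<forall>b\<in>B. \<exists>i. row i M = b"
    using B(1) by (auto simp: rows_def)
  then obtain g where g: "\<And>b. b \<in> B \<Longrightarrow> row (g b) M = b"
    using bchoice[of B "\<lambda>b i. row i M = b"] by blast
  have inj: "inj_on g B"
    using g by (rule inj_on_inverseI)
  have "\<exists>u. axis i 1 = (\<Sum>b\<in>B. u b *s b)" for i
  proof -
    have "axis i 1 \<in> vec.span B"
      by (simp add: span)
    then show ?thesis
      unfolding vec.span_finite[OF fin] by (rule rangeE) blast
  qed
  then obtain u where u: "\<And>i. axis i 1 = (\<Sum>b\<in>B. u i b *s b)"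
    using choice[of "\<lambda>i u. axis i 1 = (\<Sum>b\<in>B. u b *s b)"] by blast
  define N :: "'a ^ 'm ^ 'n" where
    "N = (\<chi> i j. if j \<in> g ` B then u i (row j M) else 0)"
  have "(N ** M) $ i $ k = mat 1 $ i $ k" for i k
  proof -
    have "(N ** M) $ i $ k = (\<Sum>j\<in>UNIV. if j \<in> g ` B then u i (row j M) * M $ j $ k else 0)"
      by (auto simp: N_def matrix_matrix_mult_def intro!: sum.cong)
    also have "\<dots> = (\<Sum>j\<in>g ` B. u i (row j M) * M $ j $ k)"
      by (simp add: sum.If_cases)
    also have "\<dots> = (\<Sum>b\<in>B. u i b * row (g b) M $ k)"
      using g by (simp add: sum.reindex[OF inj] row_def)
    also have "\<dots> = (\<Sum>b\<in>B. u i b *s b) $ k"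
      using g by simp
    also have "\<dots> = mat 1 $ i $ k"
      unfolding u[symmetric] by (auto simp: axis_def mat_def)
    finally show ?thesis .
  qed
  then have "N ** M = mat 1"
    by (simp add: vec_eq_iff)
  moreover have "l0_norm N \<le> CARD('n)\<^sup>2"
  proof -
    have "{(i, j). N $ i $ j \<noteq> 0} \<subseteq> UNIV \<times> g ` B"
      by (auto simp: N_def split: if_splits)
    then have "l0_norm N \<le> card ((UNIV :: 'n set) \<times> g ` B)"
      unfolding l0_norm_def by (intro card_mono) (use fin in auto)
    also have "\<dots> = CARD('n)\<^sup>2"
      by (simp add: card_cartesian_product card_image[OF inj] card_B power2_eq_square)
    finally show ?thesis .
  qed
  ultimately show ?thesis
    using that by blast
qed

text \<open>Stated for the common sort of the reals and the complex numbers, so that one proof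
  serves both fields.\<close>

lemma sparse_dual_frame:
  fixes \<Phi> :: "'a::{conjugatable_field,real_normed_field} ^ 'm ^ 'n"
  assumes "frame_matrix \<Phi>"
  shows "\<exists>\<Psi> :: 'a ^ 'm ^ 'n. dual_frame_of \<Psi> \<Phi> \<and> l0_norm \<Psi> \<le> CARD('n)\<^sup>2"
proof -
  obtain \<Psi> :: "'a ^ 'm ^ 'n"
    where \<Psi>: "\<Psi> ** conj_transpose \<Phi> = mat 1" "l0_norm \<Psi> \<le> CARD('n)\<^sup>2"
    using sparse_left_inverse[OF frame_matrix_imp_inj[OF assms]] by blast
  \<comment> \<open>Conjugate transposition moves the identity to the other side:
    \<open>\<Psi> \<Phi>\<^sup>* = I\<close> becomes \<open>\<Phi> \<Psi>\<^sup>* = I\<close>, the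
    form that yields the frame bounds of \<open>\<Psi>\<close>.\<close>
  have "\<Phi> ** conj_transpose \<Psi> = conj_transpose (\<Psi> ** conj_transpose \<Phi>)"
    by (simp add: conj_transpose_matrix_mult conj_transpose_conj_transpose)
  then have "frame_matrix \<Psi>"
    by (intro frame_matrix_if_right_inverse) (simp add: \<Psi> conj_transpose_mat_1)
  with \<Psi> show ?thesis
    unfolding dual_frame_of_def by blast
qed

theorem lemma3p1:
  shows "(\<forall>\<Phi> :: real ^ 'm ^ 'n. frame_matrix \<Phi> \<longrightarrow>
            (\<exists>\<Psi> :: real ^ 'm ^ 'n. dual_frame_of \<Psi> \<Phi> \<and> l0_norm \<Psi> \<le> CARD('n)\<^sup>2)) \<and>
         (\<forall>\<Phi> :: complex ^ 'm ^ 'n. frame_matrix \<Phi> \<longrightarrow>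
            (\<exists>\<Psi> :: complex ^ 'm ^ 'n. dual_frame_of \<Psi> \<Phi> \<and> l0_norm \<Psi> \<le> CARD('n)\<^sup>2))"
  by (intro conjI allI impI sparse_dual_frame)

end
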